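(* Let $V$ and $V'$ be left vector spaces of finite dimensions $n$ and $n'$ over division rings $R$ and $R'$, respectively, and let $l:V\to V'$ be a semilinear injection. Then $l$ is a semilinear embedding if and only if for every linear automorphism $u\in\mathrm{GL}(V)$ there exists a linear automorphism $u'\in\mathrm{GL}(V')$ such that $l\circ u=u'\circ l$.
   Context: A map $l:V\to V'$ is semilinear if it is additive and there is a ring homomorphism $\sigma:R\to R'$ with $l(ax)=\sigma(a)l(x)$ for all $a\in R$, $x\in V$. A semilinear embedding is a semilinear injection that maps every linearly independent subset of $V$ to a linearly independent subset of $V'$ (equivalently, when $n\le n'$, the image of every independent $n$-element subset is independent). *)

theory Defs
  imports Complex_Main
begin

text \<open>
  The library locales \<^locale>\<open>module\<close> and \<^locale>\<open>vector_space\<close> require commutative scalars. The notions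
  below restate theirs over a \<^class>\<open>division_ring\<close>, with scalars acting on the left.
\<close>

locale left_vector_space =
  fixes scale :: "'r::division_ring \<Rightarrow> 'v::ab_group_add \<Rightarrow> 'v"
  assumes scale_right_distrib: "scale a (x + y) = scale a x + scale a y"
    and scale_left_distrib: "scale (a + b) x = scale a x + scale b x"
    and scale_scale: "scale a (scale b x) = scale (a * b) x"
    and scale_one: "scale 1 x = x"

definition lin_span :: "('r::division_ring \<Rightarrow> 'v::ab_group_add \<Rightarrow> 'v) \<Rightarrow> 'v set \<Rightarrow> 'v set"
  where "lin_span scale S = {\<Sum>v\<in>T. scale (c v) v | T c. finite T \<and> T \<subseteq> S}"

definition lin_indep :: "('r::division_ring \<Rightarrow> 'v::ab_group_add \<Rightarrow> 'v) \<Rightarrow> 'v set \<Rightarrow> bool"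
  where "lin_indep scale S \<longleftrightarrow>
    (\<forall>T c. finite T \<longrightarrow> T \<subseteq> S \<longrightarrow> (\<Sum>v\<in>T. scale (c v) v) = 0 \<longrightarrow> (\<forall>v\<in>T. c v = 0))"

definition has_finite_dim :: "('r::division_ring \<Rightarrow> 'v::ab_group_add \<Rightarrow> 'v) \<Rightarrow> nat \<Rightarrow> bool"
  where "has_finite_dim scale n \<longleftrightarrow>
    (\<exists>B. finite B \<and> card B = n \<and> lin_indep scale B \<and> lin_span scale B = UNIV)"

text \<open>
  Ring homomorphisms are unital. Over division rings this excludes exactly the zero map, and it
  makes no difference for a semilinear map that is not identically zero.
\<close>

definition division_ring_hom :: "('r::division_ring \<Rightarrow> 's::division_ring) \<Rightarrow> bool"
  where "division_ring_hom \<sigma> \<longleftrightarrow>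
    (\<forall>a b. \<sigma> (a + b) = \<sigma> a + \<sigma> b) \<and> (\<forall>a b. \<sigma> (a * b) = \<sigma> a * \<sigma> b) \<and> \<sigma> 1 = 1"

definition semilinear ::
  "('r::division_ring \<Rightarrow> 'v::ab_group_add \<Rightarrow> 'v) \<Rightarrow> ('s::division_ring \<Rightarrow> 'w::ab_group_add \<Rightarrow> 'w)
    \<Rightarrow> ('v \<Rightarrow> 'w) \<Rightarrow> bool"
  where "semilinear scale scale' l \<longleftrightarrow>
    additive l \<and> (\<exists>\<sigma>. division_ring_hom \<sigma> \<and> (\<forall>a x. l (scale a x) = scale' (\<sigma> a) (l x)))"

definition semilinear_embedding ::
  "('r::division_ring \<Rightarrow> 'v::ab_group_add \<Rightarrow> 'v) \<Rightarrow> ('s::division_ring \<Rightarrow> 'w::ab_group_add \<Rightarrow> 'w)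
    \<Rightarrow> ('v \<Rightarrow> 'w) \<Rightarrow> bool"
  where "semilinear_embedding scale scale' l \<longleftrightarrow>
    semilinear scale scale' l \<and> inj l \<and> (\<forall>S. lin_indep scale S \<longrightarrow> lin_indep scale' (l ` S))"

definition GL :: "('r::division_ring \<Rightarrow> 'v::ab_group_add \<Rightarrow> 'v) \<Rightarrow> ('v \<Rightarrow> 'v) set"
  where "GL scale = {u. additive u \<and> (\<forall>a x. u (scale a x) = scale a (u x)) \<and> bij u}"

end

theory Submission
  imports Defs
begin

text \<open>
  If \<open>l\<close> maps a basis \<open>B\<close> of \<open>V\<close> to an independent set, complete \<open>l ` B\<close> to a basis of \<open>V'\<close> by a
  set \<open>C\<close>, and let \<open>u'\<close> send \<open>l b\<close> to \<open>l (u b)\<close> and fix \<open>C\<close> pointwise. The assignment \<open>u \<mapsto> u'\<close> is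
  multiplicative, so \<open>u'\<close> is invertible; no dimension count is needed.

  Conversely, let \<open>\<Sum>v\<in>T. c v \<cdot> l v = 0\<close> with \<open>T\<close> independent and \<open>c b \<noteq> 0\<close>. Choose a transvection
  \<open>u\<close> with \<open>u b = b + b\<^sub>1\<close> that fixes the rest of \<open>T\<close>, where \<open>b\<^sub>1 \<in> T - {b}\<close> (if
  \<open>T = {b}\<close>, injectivity is violated at once). Applying
  \<open>u'\<close> to the relation and subtracting gives \<open>c b \<cdot> l b\<^sub>1 = 0\<close>, contrary to injectivity.
\<close>

section \<open>Spans and linear independence over a division ring\<close>

context left_vector_space
begin

sublocale scale_left: additive "\<lambda>a. scale a x" for x
  by unfold_locales (rule scale_left_distrib)

sublocale scale_right: additive "scale a" for a
  by unfold_locales (rule scale_right_distrib)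

lemma scale_eq_0_iff: "scale a x = 0 \<longleftrightarrow> a = 0 \<or> x = 0"
proof -
  have "x = 0" if "scale a x = 0" "a \<noteq> 0"
  proof -
    have "scale (inverse a) (scale a x) = x"
      using that(2) by (simp add: scale_scale scale_one)
    then show ?thesis
      using that(1) scale_right.zero by simp
  qed
  then show ?thesis
    using scale_left.zero scale_right.zero by auto
qed

text \<open>Padding with zero coefficients replaces a varying index set by the fixed set
  \<open>D\<close>. Span and independence of a finite set thereby become statements about
  coefficient functions on the whole set.\<close>

lemma sum_scale_extend:
  assumes "finite D" "T \<subseteq> D"
  shows "(\<Sum>v\<in>T. scale (c v) v) = (\<Sum>v\<in>D. scale (if v \<in> T then c v else 0) v)"
  by (rule sum.mono_neutral_cong_left) (use assms scale_left.zero in auto)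

lemma lin_span_finite:
  assumes "finite D"
  shows "lin_span scale D = range (\<lambda>c. \<Sum>v\<in>D. scale (c v) v)"
proof
  show "lin_span scale D \<subseteq> range (\<lambda>c. \<Sum>v\<in>D. scale (c v) v)"
  proof
    fix x
    assume "x \<in> lin_span scale D"
    then obtain T c where "T \<subseteq> D" and x: "x = (\<Sum>v\<in>T. scale (c v) v)"
      by (auto simp: lin_span_def)
    show "x \<in> range (\<lambda>c. \<Sum>v\<in>D. scale (c v) v)"
      unfolding x sum_scale_extend[OF assms \<open>T \<subseteq> D\<close>] by (rule rangeI)
  qed
  show "range (\<lambda>c. \<Sum>v\<in>D. scale (c v) v) \<subseteq> lin_span scale D"
    using assms by (auto simp: lin_span_def)
qed

lemma lin_indep_finite:
  assumes "finite D"
  shows "lin_indep scale D \<longleftrightarrow> (\<forall>c. (\<Sum>v\<in>D. scale (c v) v) = 0 \<longrightarrow> (\<forall>v\<in>D. c v = 0))"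
proof
  assume "lin_indep scale D"
  then show "\<forall>c. (\<Sum>v\<in>D. scale (c v) v) = 0 \<longrightarrow> (\<forall>v\<in>D. c v = 0)"
    unfolding lin_indep_def using assms by blast
next
  assume *: "\<forall>c. (\<Sum>v\<in>D. scale (c v) v) = 0 \<longrightarrow> (\<forall>v\<in>D. c v = 0)"
  show "lin_indep scale D"
    unfolding lin_indep_def
  proof (intro allI impI)
    fix T c
    assume "T \<subseteq> D" "(\<Sum>v\<in>T. scale (c v) v) = 0"
    then have "(\<Sum>v\<in>D. scale (if v \<in> T then c v else 0) v) = 0"
      using sum_scale_extend[OF assms \<open>T \<subseteq> D\<close>, of c] by simp
    then have "\<forall>v\<in>D. (if v \<in> T then c v else 0) = 0"
      by (rule *[rule_format, THEN ballI])
    then show "\<forall>v\<in>T. c v = 0"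
      using \<open>T \<subseteq> D\<close> by (metis subsetD)
  qed
qed

lemma lin_indep_subset: "lin_indep scale S \<Longrightarrow> T \<subseteq> S \<Longrightarrow> lin_indep scale T"
  unfolding lin_indep_def by (meson subset_trans)

lemma zero_not_in_lin_indep:
  assumes "lin_indep scale S"
  shows "0 \<notin> S"
proof
  assume "0 \<in> S"
  then have "lin_indep scale {0}"
    using lin_indep_subset[OF assms] by simp
  then show False
    \<comment> \<open>The constant coefficient 1 gives a nontrivial relation on
      \<open>{0}\<close>.\<close>
    using scale_right.zero by (auto simp: lin_indep_finite dest: spec[of _ "\<lambda>_. 1"])
qed

lemma lin_span_base: "x \<in> S \<Longrightarrow> x \<in> lin_span scale S"
  unfolding lin_span_def
  by (auto intro!: exI[of _ "{x}"] exI[of _ "\<lambda>_. 1"] simp: scale_one)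

lemma lin_span_add:
  assumes "finite D" "x \<in> lin_span scale D" "y \<in> lin_span scale D"
  shows "x + y \<in> lin_span scale D"
proof -
  obtain c d where "x = (\<Sum>v\<in>D. scale (c v) v)" "y = (\<Sum>v\<in>D. scale (d v) v)"
    using assms by (auto simp: lin_span_finite)
  then have *: "x + y = (\<Sum>v\<in>D. scale (c v + d v) v)"
    by (simp add: scale_left_distrib sum.distrib)
  show ?thesis
    unfolding lin_span_finite[OF assms(1)] by (rule range_eqI) (rule *)
qed

lemma lin_span_scale:
  assumes "finite D" "x \<in> lin_span scale D"
  shows "scale a x \<in> lin_span scale D"
proof -
  obtain c where "x = (\<Sum>v\<in>D. scale (c v) v)"
    using assms by (auto simp: lin_span_finite)
  then have *: "scale a x = (\<Sum>v\<in>D. scale (a * c v) v)"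
    by (simp add: scale_right.sum scale_scale)
  show ?thesis
    unfolding lin_span_finite[OF assms(1)] by (rule range_eqI) (rule *)
qed

lemma lin_span_sum:
  assumes "finite D" "\<And>v. v \<in> T \<Longrightarrow> v \<in> lin_span scale D"
  shows "(\<Sum>v\<in>T. scale (c v) v) \<in> lin_span scale D"
proof -
  have zero: "0 \<in> lin_span scale D"
    unfolding lin_span_def by (auto intro!: exI[of _ "{}"])
  show ?thesis
    using assms(2)
    by (induction T rule: infinite_finite_induct)
      (simp_all add: zero lin_span_add[OF assms(1)] lin_span_scale[OF assms(1)])
qed

text \<open>In a relation on \<open>insert b D\<close> the coefficient of \<open>b\<close> must
  vanish: otherwise multiplying from the left by its inverse would express \<open>b\<close> through
  \<open>D\<close>. What remains is a relation on \<open>D\<close>.\<close>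

lemma lin_indep_insert:
  assumes "finite D" "lin_indep scale D" "b \<notin> lin_span scale D"
  shows "lin_indep scale (insert b D)"
proof -
  have "\<forall>v\<in>insert b D. c v = 0" if sum0: "(\<Sum>v\<in>insert b D. scale (c v) v) = 0" for c
  proof -
    have b: "b \<notin> D"
      using assms(3) lin_span_base by blast
    then have eq: "scale (c b) b + (\<Sum>v\<in>D. scale (c v) v) = 0"
      using sum0 assms(1) by simp
    have "c b = 0"
    proof (rule ccontr)
      assume "c b \<noteq> 0"
      have "scale (c b) b = scale (-1) (\<Sum>v\<in>D. scale (c v) v)"
        using eq by (simp add: scale_left.minus scale_one eq_neg_iff_add_eq_0)
      also have "\<dots> \<in> lin_span scale D"
        using assms(1) by (intro lin_span_scale) (auto simp: lin_span_finite)
      finally have "scale (inverse (c b)) (scale (c b) b) \<in> lin_span scale D"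
        by (rule lin_span_scale[OF assms(1)])
      then show False
        using \<open>c b \<noteq> 0\<close> assms(3) by (simp add: scale_scale scale_one)
    qed
    moreover from this have "(\<Sum>v\<in>D. scale (c v) v) = 0"
      using eq scale_left.zero by simp
    then have "\<forall>v\<in>D. c v = 0"
      using assms(1,2) lin_indep_finite by blast
    ultimately show ?thesis
      by simp
  qed
  then show ?thesis
    using assms(1) by (simp add: lin_indep_finite del: sum.insert)
qed

section \<open>Bases and completion of independent sets\<close>

definition basis :: "'v set \<Rightarrow> bool"
  where "basis D \<longleftrightarrow> finite D \<and> lin_indep scale D \<and> lin_span scale D = UNIV"

text \<open>Among the subsets \<open>A\<close> of \<open>B\<close> with \<open>S \<union> A\<close>
  independent, take a maximal one. An element of \<open>B\<close> outside the span of
  \<open>S \<union> A\<close> could still be adjoined, so all of \<open>B\<close>, and hence the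
  whole space, lies in that span.\<close>

lemma lin_indep_extend_basis:
  assumes "basis B" "finite S" "lin_indep scale S"
  obtains D where "basis D" "S \<subseteq> D"
proof -
  define F where "F = {A. A \<subseteq> B \<and> lin_indep scale (S \<union> A)}"
  have fin: "finite B"
    using assms(1) by (simp add: basis_def)
  then have "finite F"
    by (simp add: F_def)
  moreover have "F \<noteq> {}"
    using assms(3) by (auto simp: F_def intro!: exI[of _ "{}"])
  ultimately obtain A where "A \<in> F" and max: "\<forall>A'\<in>F. A \<subseteq> A' \<longrightarrow> A = A'"
    using finite_has_maximal by metis
  then have A: "A \<subseteq> B" "lin_indep scale (S \<union> A)"
    by (simp_all add: F_def)
  have finSA: "finite (S \<union> A)"
    using A assms(2) fin finite_subset by blast
  have B: "b \<in> lin_span scale (S \<union> A)" if "b \<in> B" for b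
  proof (rule ccontr)
    assume b: "b \<notin> lin_span scale (S \<union> A)"
    have "insert b A \<in> F"
      using lin_indep_insert[OF finSA A(2) b] A(1) that by (simp add: F_def)
    then have "b \<in> A"
      using max by blast
    then show False
      using b lin_span_base by blast
  qed
  have "lin_span scale B \<subseteq> lin_span scale (S \<union> A)"
    unfolding lin_span_finite[OF fin] using lin_span_sum[OF finSA B] by blast
  then have "basis (S \<union> A)"
    using A(2) assms(1) finSA by (simp add: basis_def top.extremum_unique)
  then show ?thesis
    using that by simp
qed

section \<open>Linear endomorphisms and their inverses\<close>

definition endo :: "('v \<Rightarrow> 'v) \<Rightarrow> bool"
  where "endo g \<longleftrightarrow> additive g \<and> (\<forall>a x. g (scale a x) = scale a (g x))"

lemma endo_sum: "endo g \<Longrightarrow> g (\<Sum>v\<in>T. scale (c v) (h v)) = (\<Sum>v\<in>T. scale (c v) (g (h v)))"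
  by (simp add: endo_def additive.sum[of g])

lemma endo_zero: "endo g \<Longrightarrow> g 0 = 0"
  by (simp add: endo_def additive.zero[of g])

lemma endo_add: "endo g \<Longrightarrow> g (x + y) = g x + g y"
  by (simp add: endo_def additive.add[of g])

lemma endo_diff: "endo g \<Longrightarrow> g (x - y) = g x - g y"
  by (simp add: endo_def additive.diff[of g])

lemma endo_scale: "endo g \<Longrightarrow> g (scale a x) = scale a (g x)"
  by (simp add: endo_def)

lemma endo_comp: "endo g \<Longrightarrow> endo h \<Longrightarrow> endo (g \<circ> h)"
  by (simp add: endo_def additive_def)

lemma endo_id: "endo id"
  by (simp add: endo_def additive_def)

lemma GL_iff: "u \<in> GL scale \<longleftrightarrow> endo u \<and> bij u"
  by (simp add: GL_def endo_def)

lemma endo_inv: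
  assumes "u \<in> GL scale"
  shows "endo (inv u)"
proof -
  have "endo u" "inj u" "surj u"
    using assms by (simp_all add: GL_iff bij_def)
  then have "inv u (x + y) = inv u x + inv u y" "inv u (scale a x) = scale a (inv u x)" for a x y
    by (simp_all add: inv_f_eq endo_add[OF \<open>endo u\<close>] endo_scale[OF \<open>endo u\<close>] surj_f_inv_f)
  then show ?thesis
    by (simp add: endo_def additive_def)
qed

section \<open>Coordinates and linear extension from a basis\<close>

lemma basis_expand:
  assumes "basis D"
  obtains c where "x = (\<Sum>v\<in>D. scale (c v) v)"
proof -
  have "x \<in> range (\<lambda>c. \<Sum>v\<in>D. scale (c v) v)"
    using assms lin_span_finite[of D] by (simp add: basis_def)
  then show ?thesis
    using that by (elim rangeE)
qed

lemma basis_coeff_unique: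
  assumes "basis D" "(\<Sum>v\<in>D. scale (c v) v) = (\<Sum>v\<in>D. scale (d v) v)" "v \<in> D"
  shows "c v = d v"
proof -
  have "(\<Sum>v\<in>D. scale (c v - d v) v) = 0"
    using assms(2) by (simp add: scale_left.diff sum_subtractf)
  then have "\<forall>v\<in>D. c v - d v = 0"
    using assms(1) lin_indep_finite[of D] unfolding basis_def by (elim conjE) fast
  then show ?thesis
    using assms(3) by simp
qed

lemma endo_eqI:
  assumes "basis D" "endo g" "endo h" "\<And>v. v \<in> D \<Longrightarrow> g v = h v"
  shows "g = h"
proof
  fix x
  obtain c where "x = (\<Sum>v\<in>D. scale (c v) v)"
    using basis_expand[OF assms(1)] .
  then show "g x = h x"
    using assms(4) by (simp add: endo_sum[OF assms(2)] endo_sum[OF assms(3)])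
qed

text \<open>The map applies \<open>f\<close> to the basis vectors in an expansion of its argument. A
  choice function \<open>r\<close> supplies the expansions, and uniqueness of coordinates makes the
  result linear.\<close>

lemma endo_extend:
  assumes "basis D"
  obtains g where "endo g" "\<And>v. v \<in> D \<Longrightarrow> g v = f v"
proof -
  have "\<forall>x. \<exists>c. x = (\<Sum>v\<in>D. scale (c v) v)"
    by (blast intro: basis_expand[OF assms])
  from choice[OF this] obtain r where r: "\<And>x. x = (\<Sum>v\<in>D. scale (r x v) v)"
    by blast
  define g where "g x = (\<Sum>v\<in>D. scale (r x v) (f v))" for x
  \<comment> \<open>By uniqueness, \<open>g\<close> may be evaluated on any expansion over
    \<open>D\<close>, not only the one chosen by \<open>r\<close>. The claims below then only
    require exhibiting suitable coefficients.\<close>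
  have g: "g (\<Sum>v\<in>D. scale (c v) v) = (\<Sum>v\<in>D. scale (c v) (f v))" for c
    unfolding g_def by (rule sum.cong) (simp_all add: basis_coeff_unique[OF assms r[symmetric]])
  have "g (x + y) = g x + g y" for x y
  proof -
    have "x + y = (\<Sum>v\<in>D. scale (r x v + r y v) v)"
      using r[of x] r[of y] by (simp add: scale_left_distrib sum.distrib)
    then have "g (x + y) = (\<Sum>v\<in>D. scale (r x v + r y v) (f v))"
      by (simp only: g)
    then show ?thesis
      by (simp add: g_def[of x] g_def[of y] scale_left_distrib sum.distrib)
  qed
  moreover have "g (scale a x) = scale a (g x)" for a x
  proof -
    have "scale a x = scale a (\<Sum>v\<in>D. scale (r x v) v)"
      using r[of x] by (rule arg_cong)
    also have "\<dots> = (\<Sum>v\<in>D. scale (a * r x v) v)"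
      by (simp add: scale_right.sum scale_scale)
    finally have "g (scale a x) = (\<Sum>v\<in>D. scale (a * r x v) (f v))"
      by (simp only: g)
    then show ?thesis
      by (simp add: g_def[of x] scale_right.sum scale_scale)
  qed
  moreover have "g v = f v" if "v \<in> D" for v
  proof -
    \<comment> \<open>Stated for arbitrary \<open>h\<close> because it serves twice: with the
      identity to recover \<open>v\<close>, and with \<open>f\<close> to obtain its image.\<close>
    have pick: "(\<Sum>w\<in>D. scale (if w = v then 1 else 0) (h w)) = h v" for h
    proof -
      have "(\<Sum>w\<in>D. scale (if w = v then 1 else 0) (h w)) = (\<Sum>w\<in>D. if w = v then h w else 0)"
        by (rule sum.cong) (simp_all add: scale_one scale_left.zero)
      then show ?thesis
        using assms that by (simp add: basis_def)
    qed
    show ?thesis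
      using g[of "\<lambda>w. if w = v then 1 else 0"] by (simp only: pick)
  qed
  ultimately show ?thesis
    by (intro that[of g]) (simp_all add: endo_def additive_def)
qed

section \<open>Construction of automorphisms\<close>

lemma GL_I:
  assumes "basis D" "endo g" "endo h"
    and "\<And>v. v \<in> D \<Longrightarrow> g (h v) = v" "\<And>v. v \<in> D \<Longrightarrow> h (g v) = v"
  shows "g \<in> GL scale"
proof -
  have "g \<circ> h = id" "h \<circ> g = id"
    using assms by (auto intro!: endo_eqI[OF assms(1)] endo_comp endo_id)
  then show ?thesis
    using assms(2) o_bij by (simp add: GL_iff)
qed

text \<open>The inverse is the transvection sending \<open>b\<close> to \<open>b - b'\<close>. Both
  maps fix \<open>b'\<close> because \<open>b \<noteq> b'\<close>, so they cancel on the basis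
  \<open>D\<close>.\<close>

lemma transvection_exists:
  assumes "basis D" "b \<in> D" "b' \<in> D" "b \<noteq> b'"
  obtains u where "u \<in> GL scale" "u b = b + b'" "\<And>v. v \<in> D - {b} \<Longrightarrow> u v = v"
proof -
  obtain g where g: "endo g" "\<And>v. v \<in> D \<Longrightarrow> g v = (if v = b then b + b' else v)"
    using endo_extend[OF assms(1), of "\<lambda>v. if v = b then b + b' else v"] by blast
  obtain h where h: "endo h" "\<And>v. v \<in> D \<Longrightarrow> h v = (if v = b then b - b' else v)"
    using endo_extend[OF assms(1), of "\<lambda>v. if v = b then b - b' else v"] by blast
  have "g \<in> GL scale"
    using g h assms
    by (intro GL_I[OF assms(1) g(1) h(1)])
      (auto simp: endo_add[OF h(1)] endo_diff[OF g(1)])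
  then show ?thesis
    using that g(2) assms(2) by simp
qed

end

section \<open>Embeddings allow automorphisms to be extended\<close>

lemma has_finite_dim_basis:
  assumes "left_vector_space scale" "has_finite_dim scale n"
  obtains B where "left_vector_space.basis scale B"
  using assms by (auto simp: has_finite_dim_def left_vector_space.basis_def)

lemma semilinear_embedding_imp_GL_extend:
  fixes scale :: "'r::division_ring \<Rightarrow> 'v::ab_group_add \<Rightarrow> 'v"
    and scale' :: "'s::division_ring \<Rightarrow> 'w::ab_group_add \<Rightarrow> 'w"
  assumes V: "left_vector_space scale" "has_finite_dim scale n"
    and V': "left_vector_space scale'" "has_finite_dim scale' n'"
    and l: "semilinear_embedding scale scale' l"
    and u: "u \<in> GL scale"
  shows "\<exists>u'\<in>GL scale'. l \<circ> u = u' \<circ> l"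
proof -
  interpret V: left_vector_space scale by (rule V)
  interpret V': left_vector_space scale' by (rule V')
  obtain \<sigma> where "additive l" and l_scale: "\<And>a x. l (scale a x) = scale' (\<sigma> a) (l x)"
    using l unfolding semilinear_embedding_def semilinear_def by auto
  interpret l: additive l by fact
  have inj: "inj l"
    using l by (simp add: semilinear_embedding_def)
  obtain B where B: "V.basis B"
    using has_finite_dim_basis[OF V] .
  then have "finite (l ` B)" "lin_indep scale' (l ` B)"
    using l by (auto simp: V.basis_def semilinear_embedding_def)
  moreover obtain B' where "V'.basis B'"
    using has_finite_dim_basis[OF V'] .
  ultimately obtain D where D: "V'.basis D" "l ` B \<subseteq> D"
    using V'.lin_indep_extend_basis by blast
  \<comment> \<open>Proved for every endomorphism \<open>v\<close>, since it is applied both to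
    \<open>u\<close> and to \<open>inv u\<close>.\<close>
  have ext: "\<exists>g. V'.endo g \<and> (\<forall>x. g (l x) = l (v x)) \<and> (\<forall>d\<in>D - l ` B. g d = d)"
    if v: "V.endo v" for v
  proof -
    obtain g where g: "V'.endo g" "\<And>d. d \<in> D \<Longrightarrow> g d = (if d \<in> l ` B then l (v (inv l d)) else d)"
      using V'.endo_extend[OF D(1), of "\<lambda>d. if d \<in> l ` B then l (v (inv l d)) else d"] by blast
    have "g (l x) = l (v x)" for x
    proof -
      obtain c where x: "x = (\<Sum>b\<in>B. scale (c b) b)"
        using V.basis_expand[OF B] .
      have "g (l x) = (\<Sum>b\<in>B. scale' (\<sigma> (c b)) (g (l b)))"
        by (simp add: x l.sum l_scale V'.endo_sum[OF g(1)])
      also have "\<dots> = (\<Sum>b\<in>B. scale' (\<sigma> (c b)) (l (v b)))"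
        using D(2) by (intro sum.cong) (auto simp: g(2) inv_f_f[OF inj])
      also have "\<dots> = l (v x)"
        by (simp add: x l.sum l_scale V.endo_sum[OF v])
      finally show ?thesis .
    qed
    then show ?thesis
      using g by auto
  qed
  have "V.endo u" "bij u"
    using u by (simp_all add: V.GL_iff)
  obtain g where g: "V'.endo g" "\<And>x. g (l x) = l (u x)" "\<And>d. d \<in> D - l ` B \<Longrightarrow> g d = d"
    using ext[OF \<open>V.endo u\<close>] by blast
  obtain h where h: "V'.endo h" "\<And>x. h (l x) = l (inv u x)" "\<And>d. d \<in> D - l ` B \<Longrightarrow> h d = d"
    using ext[OF V.endo_inv[OF u]] by blast
  have "g (h d) = d \<and> h (g d) = d" if "d \<in> D" for d
  proof (cases "d \<in> l ` B")
    case True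
    then show ?thesis
      using \<open>bij u\<close> by (auto simp: g(2) h(2) bij_is_surj surj_f_inv_f bij_is_inj inv_f_f)
  next
    case False
    then show ?thesis
      using that g(3) h(3) by simp
  qed
  then have "g \<in> GL scale'"
    using V'.GL_I[OF D(1) g(1) h(1)] by blast
  moreover have "l \<circ> u = g \<circ> l"
    using g(2) by auto
  ultimately show ?thesis
    by blast
qed

section \<open>Extendability of automorphisms forces independence of images\<close>

lemma GL_extend_imp_semilinear_embedding:
  fixes scale :: "'r::division_ring \<Rightarrow> 'v::ab_group_add \<Rightarrow> 'v"
    and scale' :: "'s::division_ring \<Rightarrow> 'w::ab_group_add \<Rightarrow> 'w"
  assumes V: "left_vector_space scale" "has_finite_dim scale n"
    and V': "left_vector_space scale'"
    and l: "semilinear scale scale' l" "inj l"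
    and GL: "\<And>u. u \<in> GL scale \<Longrightarrow> \<exists>u'\<in>GL scale'. l \<circ> u = u' \<circ> l"
  shows "semilinear_embedding scale scale' l"
proof -
  interpret V: left_vector_space scale by (rule V)
  interpret V': left_vector_space scale' by (rule V')
  interpret l: additive l using l(1) by (simp add: semilinear_def)
  have l_nonzero: "l x \<noteq> 0" if "x \<noteq> 0" for x
    using that injD[OF l(2)] l.zero by metis
  obtain B where B: "V.basis B"
    using has_finite_dim_basis[OF V] .
  \<comment> \<open>The coefficients are arbitrary scalars of \<open>V'\<close>. They need not lie
    in the image of the ring homomorphism, so the relation cannot simply be pulled back along
    \<open>l\<close>.\<close>
  have "c (l b) = 0"
    if T: "finite T" "lin_indep scale T" and sum0: "(\<Sum>v\<in>T. scale' (c (l v)) (l v)) = 0"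
      and b: "b \<in> T" for T c b
  proof (cases "T = {b}")
    case True
    then have "scale' (c (l b)) (l b) = 0" "b \<noteq> 0"
      using sum0 V.zero_not_in_lin_indep[OF T(2)] by auto
    then show ?thesis
      using l_nonzero V'.scale_eq_0_iff by blast
  next
    case False
    then obtain b' where b': "b' \<in> T" "b \<noteq> b'"
      using b by blast
    \<comment> \<open>A transvection is prescribed on a basis, so \<open>T\<close> is completed
      first; \<open>u\<close> then fixes \<open>T - {b}\<close>.\<close>
    obtain D where D: "V.basis D" "T \<subseteq> D"
      using V.lin_indep_extend_basis[OF B T] .
    then obtain u where u: "u \<in> GL scale" "u b = b + b'" "\<And>v. v \<in> D - {b} \<Longrightarrow> u v = v"
      using V.transvection_exists[of D b b'] b b' by blast
    obtain u' where u': "u' \<in> GL scale'" "l \<circ> u = u' \<circ> l"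
      using GL[OF u(1)] by blast
    have "V'.endo u'"
      using u'(1) by (simp add: V'.GL_iff)
    have "0 = u' (\<Sum>v\<in>T. scale' (c (l v)) (l v))"
      by (simp add: sum0 V'.endo_zero[OF \<open>V'.endo u'\<close>])
    also have "\<dots> = (\<Sum>v\<in>T. scale' (c (l v)) (l (u v)))"
      using fun_cong[OF u'(2)] by (simp add: V'.endo_sum[OF \<open>V'.endo u'\<close>])
    \<comment> \<open>Only the summand at \<open>b\<close> changes, by the contribution of
      \<open>b'\<close>. The unchanged part is the original relation and vanishes.\<close>
    also have "\<dots> = (\<Sum>v\<in>T. scale' (c (l v)) (l v) + (if v = b then scale' (c (l b)) (l b') else 0))"
      using D(2) by (intro sum.cong) (auto simp: u(2,3) l.add V'.scale_right_distrib)
    also have "\<dots> = scale' (c (l b)) (l b')"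
      using T(1) b by (simp add: sum.distrib sum0)
    finally show ?thesis
      using l_nonzero b' V.zero_not_in_lin_indep[OF T(2)] V'.scale_eq_0_iff by metis
  qed note relation = this
  have "lin_indep scale' (l ` S)" if S: "lin_indep scale S" for S
    unfolding lin_indep_def
  proof (intro allI impI)
    fix T' c
    assume T': "finite T'" "T' \<subseteq> l ` S" and sum0: "(\<Sum>w\<in>T'. scale' (c w) w) = 0"
    \<comment> \<open>A finite subset of the image lifts to a finite \<open>T \<subseteq> S\<close>,
      and injectivity reindexes the sum over \<open>T\<close> without collapsing terms.\<close>
    obtain T where T: "T \<subseteq> S" "finite T" "T' = l ` T"
      using finite_subset_image[OF T'] by blast
    have "(\<Sum>v\<in>T. scale' (c (l v)) (l v)) = 0"
      using sum0 by (simp add: T(3) sum.reindex[OF inj_on_subset[OF l(2) subset_UNIV]])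
    then show "\<forall>w\<in>T'. c w = 0"
      using relation[OF T(2) V.lin_indep_subset[OF S T(1)]] T(3) by blast
  qed
  then show ?thesis
    using l by (simp add: semilinear_embedding_def)
qed

theorem theorem5p1:
  fixes scale :: "'r::division_ring \<Rightarrow> 'v::ab_group_add \<Rightarrow> 'v"
    and scale' :: "'s::division_ring \<Rightarrow> 'w::ab_group_add \<Rightarrow> 'w"
    and n n' :: nat
    and l :: "'v \<Rightarrow> 'w"
  assumes "left_vector_space scale" and "has_finite_dim scale n"
    and "left_vector_space scale'" and "has_finite_dim scale' n'"
    and "semilinear scale scale' l" and "inj l"
  shows "semilinear_embedding scale scale' l \<longleftrightarrow>
    (\<forall>u \<in> GL scale. \<exists>u' \<in> GL scale'. l \<circ> u = u' \<circ> l)"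
  using semilinear_embedding_imp_GL_extend[OF assms(1-4)]
    GL_extend_imp_semilinear_embedding[OF assms(1-3,5,6)] by blast

end
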